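(* Let $B=\{100,012\}$, and for $m\ge1$ let $\mathcal T_m$ be the generating tree for all inversion sequences of the form $\pi=0^mm\pi'$ that avoid $B$ (i.e. the plane tree $\mathcal T(B;0^mm)$). Then the generating tree $\mathcal T[B]$ is given by $$\text{Root: } a_1,\qquad \text{Rules: } a_m\rightsquigarrow a_{m+1},\mathcal T_1,\mathcal T_2,\ldots,\mathcal T_m \quad (m\ge1),$$ where $a_m=0^m$. That is, the root is labelled $a_1$, and a node labelled $a_m$ has exactly $m+1$ children, the subtrees at which are, from left to right and up to plane tree isomorphism, the subtree of a node labelled $a_{m+1}$ followed by $\mathcal T_1,\mathcal T_2,\dots,\mathcal T_m$.
   Context: For $n\ge 0$, $I_n$ denotes the set of inversion sequences $e=e_0e_1\cdots e_n$, i.e. integer sequences with $0\le e_i\le i$ for each $0\le i\le n$. An inversion sequence contains a pattern $\tau$ if it has a (not necessarily consecutive) subsequence order isomorphic to $\tau$ (including equalities); otherwise it avoids $\tau$. $I_n(B)$ is the set of $e\in I_n$ avoiding all patterns in $B$. $\mathcal T(B)$ is the rooted plane tree with root $0$ whose level-$n$ nodes are the elements of $I_n(B)$ (root at level 0), where the parent of $e_0\cdots e_n$ is $e_0\cdots e_{n-1}$ and siblings are ordered left to right by increasing last letter. For a node $e$, $\mathcal T(B;e)$ is the plane subtree consisting of $e$ and its descendants. Nodes $v,w$ are equivalent, $v\sim w$, if $\mathcal T(B;v)\cong\mathcal T(B;w)$ as plane trees. $\mathcal T[B]$ is the tree $\mathcal T(B)$ in which each node is relabelled by the representative of its equivalence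 class, namely the left-most node at the lowest-numbered level in the class. Here $0^m$ is the word of $m$ zeros and $0^mm$ is $0^m$ followed by the letter $m$. *)

theory Defs
  imports Main "HOL-Library.Sublist"
begin

definition order_isomorphic :: "nat list \<Rightarrow> nat list \<Rightarrow> bool" where
  "order_isomorphic xs ys \<longleftrightarrow> length xs = length ys \<and>
     (\<forall>i<length xs. \<forall>j<length xs.
        (xs ! i < xs ! j \<longleftrightarrow> ys ! i < ys ! j) \<and> (xs ! i = xs ! j \<longleftrightarrow> ys ! i = ys ! j))"

definition contains_pattern :: "nat list \<Rightarrow> nat list \<Rightarrow> bool" where
  "contains_pattern e \<tau> \<longleftrightarrow> (\<exists>s. subseq s e \<and> order_isomorphic s \<tau>)"

definition inv_seqs :: "nat \<Rightarrow> nat list set" where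
  "inv_seqs n = {e. length e = Suc n \<and> (\<forall>i\<le>n. e ! i \<le> i)}"

definition avoiders :: "nat list set \<Rightarrow> nat \<Rightarrow> nat list set" where
  "avoiders B n = {e \<in> inv_seqs n. \<forall>\<tau>\<in>B. \<not> contains_pattern e \<tau>}"

text \<open>Plane trees, possibly infinite: each vertex carries the list of its children from left to
  right.\<close>

record 'v plane_tree =
  verts :: "'v set"
  root :: 'v
  children :: "'v \<Rightarrow> 'v list"

record ('v, 'l) labelled_plane_tree = "'v plane_tree" +
  label :: "'v \<Rightarrow> 'l"

definition subtree :: "('v, 'z) plane_tree_scheme \<Rightarrow> 'v \<Rightarrow> ('v, 'z) plane_tree_scheme" where
  "subtree T v = T\<lparr>verts := {w. (v, w) \<in> {(x, y). x \<in> verts T \<and> y \<in> set (children T x)}\<^sup>*},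
                    root := v\<rparr>"

text \<open>Isomorphism of plane trees disregards any labels.\<close>

definition plane_tree_iso ::
    "('v, 'y) plane_tree_scheme \<Rightarrow> ('w, 'z) plane_tree_scheme \<Rightarrow> bool" (infix "\<cong>\<^sub>p" 50) where
  "T \<cong>\<^sub>p U \<longleftrightarrow> (\<exists>f. bij_betw f (verts T) (verts U) \<and> f (root T) = root U \<and>
     (\<forall>v\<in>verts T. children U (f v) = map f (children T v)))"

text \<open>The tree \<open>\<T>(B)\<close>. The set of letters extending \<open>e\<close> to a child is finite, as such a letter is at
  most \<open>length e\<close>.\<close>

definition gen_tree :: "nat list set \<Rightarrow> nat list plane_tree" where
  "gen_tree B = \<lparr>verts = (\<Union>n. avoiders B n), root = [0],
     children = (\<lambda>e. map (\<lambda>k. e @ [k]) (sorted_list_of_set {k. e @ [k] \<in> (\<Union>n. avoiders B n)}))\<rparr>"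

definition equiv_class :: "nat list set \<Rightarrow> nat list \<Rightarrow> nat list set" where
  "equiv_class B v = {w \<in> verts (gen_tree B). subtree (gen_tree B) v \<cong>\<^sub>p subtree (gen_tree B) w}"

text \<open>The left-most node at the lowest-numbered level of the class of \<open>v\<close>. The level of a word is
  its length minus one, and the nodes of one level are ordered from left to right lexicographically,
  so this is the least element for the order comparing first lengths, then words.\<close>

definition representative :: "nat list set \<Rightarrow> nat list \<Rightarrow> nat list" where
  "representative B v =
     (THE w. w \<in> equiv_class B v \<and> (\<forall>u\<in>equiv_class B v. u \<noteq> w \<longrightarrow> (w, u) \<in> lenlex less_than))"

text \<open>The tree \<open>\<T>[B]\<close>. Different nodes may receive the same label, so the vertices remain those of
  \<open>\<T>(B)\<close>.\<close>

definition reduced_tree :: "nat list set \<Rightarrow> (nat list, nat list) labelled_plane_tree" where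
  "reduced_tree B = plane_tree.extend (gen_tree B) \<lparr>label = representative B\<rparr>"

end

theory Submission
  imports Defs
begin

text \<open>A node labelled \<open>a m\<close> is equivalent to \<open>0\<^sup>m\<close>, so everything can be read off at \<open>0\<^sup>m\<close>.

  A word of length \<open>l\<close> has at most \<open>l + 1\<close> children, and \<open>0\<^sup>m\<close> attains this bound. Equivalent nodes
  have equally many children, so no word shorter than \<open>0\<^sup>m\<close> is equivalent to it; as \<open>0\<^sup>m\<close> is also the
  left-most node of its level, it represents its class (lemma \<open>representative_eq_zeros\<close>). In
  particular, the left-most child \<open>0\<^sup>m\<^sup>+\<^sup>1\<close> of \<open>0\<^sup>m\<close> is a label of the reduced tree.

  For \<open>1 \<le> j \<le> m\<close>, after the prefix \<open>0\<^sup>mj\<close> the avoidance of \<open>012\<close> forces the nonzero letters to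
  decrease weakly. All later letters are then at most \<open>j \<le> m\<close>, so the bound \<open>e\<^sub>i \<le> i\<close> imposes
  nothing, and the avoidance of \<open>B\<close> by \<open>0\<^sup>mj\<pi>\<close> becomes a condition on \<open>j\<pi>\<close> alone that does not mention
  \<open>m\<close> (lemma \<open>zeros_append_in_verts_iff\<close>). Deleting \<open>m - j\<close> initial zeros is hence an isomorphism
  from the subtree at \<open>0\<^sup>mj\<close> onto the subtree at \<open>0\<^sup>jj\<close> (lemma \<open>subtree_zeros_iso\<close>).\<close>

section \<open>Plane trees and their subtrees\<close>

lemma subtree_simps [simp]:
  "root (subtree T v) = v"
  "children (subtree T v) = children T"
  by (simp_all add: subtree_def)

lemma verts_subtree:
  "verts (subtree T v) = {w. (v, w) \<in> {(x, y). x \<in> verts T \<and> y \<in> set (children T x)}\<^sup>*}"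
  by (simp add: subtree_def)

lemma root_in_subtree: "v \<in> verts (subtree T v)"
  by (simp add: verts_subtree)

lemma verts_subtree_trans:
  "c \<in> verts (subtree T v) \<Longrightarrow> verts (subtree T c) \<subseteq> verts (subtree T v)"
  by (auto simp: verts_subtree)

lemma child_in_subtree:
  "\<lbrakk>x \<in> verts (subtree T v); x \<in> verts T; y \<in> set (children T x)\<rbrakk> \<Longrightarrow> y \<in> verts (subtree T v)"
  by (auto simp: verts_subtree intro: rtrancl_into_rtrancl)

lemma subtree_induct [consumes 1, case_names root child]:
  assumes "w \<in> verts (subtree T v)" and "P v"
    and "\<And>x y. \<lbrakk>x \<in> verts (subtree T v); x \<in> verts T; y \<in> set (children T x); P x\<rbrakk> \<Longrightarrow> P y"
  shows "P w"
proof -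
  have "(v, w) \<in> {(x, y). x \<in> verts T \<and> y \<in> set (children T x)}\<^sup>*"
    using assms(1) by (simp add: verts_subtree)
  then show ?thesis
    by (induction rule: rtrancl_induct) (use assms(2,3) in \<open>auto simp: verts_subtree\<close>)
qed

text \<open>The children lists of a record need not stay within its vertices; the trees considered here
  are those where they do.\<close>

definition child_closed :: "('v, 'z) plane_tree_scheme \<Rightarrow> bool" where
  "child_closed T \<longleftrightarrow> (\<forall>x\<in>verts T. set (children T x) \<subseteq> verts T)"

lemma subtree_subset_verts:
  assumes "child_closed T" and "v \<in> verts T"
  shows "verts (subtree T v) \<subseteq> verts T"
proof
  fix w assume "w \<in> verts (subtree T v)"
  then show "w \<in> verts T"
    by (induction rule: subtree_induct) (use assms in \<open>auto simp: child_closed_def\<close>)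
qed

text \<open>A map that respects children and is injective on the descendants of \<open>v\<close> is an isomorphism onto
  the subtree at the image of \<open>v\<close>: surjectivity holds because every descendant of \<open>f v\<close> is reached
  through the lists of children.\<close>

lemma subtree_isoI:
  assumes T: "child_closed T" "v \<in> verts T"
    and U: "child_closed U" "f v \<in> verts U"
    and inj: "inj_on f (verts (subtree T v))"
    and ch: "\<And>x. x \<in> verts (subtree T v) \<Longrightarrow> children U (f x) = map f (children T x)"
  shows "subtree T v \<cong>\<^sub>p subtree U (f v)"
proof -
  have sub: "verts (subtree T v) \<subseteq> verts T" "verts (subtree U (f v)) \<subseteq> verts U"
    using subtree_subset_verts[OF T] subtree_subset_verts[OF U] by simp_all
  have "f w \<in> verts (subtree U (f v))" if "w \<in> verts (subtree T v)" for w
    using that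
  proof (induction rule: subtree_induct)
    case root
    show ?case by (rule root_in_subtree)
  next
    case (child x y)
    then have "f y \<in> set (children U (f x))" using ch by simp
    with child(4) sub(2) show ?case by (meson child_in_subtree subsetD)
  qed
  moreover have "y \<in> f ` verts (subtree T v)" if "y \<in> verts (subtree U (f v))" for y
    using that
  proof (induction rule: subtree_induct)
    case root
    show ?case by (intro imageI root_in_subtree)
  next
    case (child x y)
    then obtain x' where x': "x = f x'" "x' \<in> verts (subtree T v)" by blast
    with child(3) ch have "y \<in> f ` set (children T x')" by simp
    then obtain y' where "y = f y'" "y' \<in> set (children T x')" by blast
    with x'(2) sub(1) show ?case by (meson child_in_subtree imageI subsetD)
  qed
  ultimately have "bij_betw f (verts (subtree T v)) (verts (subtree U (f v)))"
    using inj by (auto simp: bij_betw_def)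
  then show ?thesis unfolding plane_tree_iso_def using ch by auto
qed

lemma plane_tree_iso_refl: "T \<cong>\<^sub>p T"
  unfolding plane_tree_iso_def by (rule exI[of _ id]) auto

lemma plane_tree_iso_trans:
  assumes "T \<cong>\<^sub>p U" and "U \<cong>\<^sub>p W"
  shows "T \<cong>\<^sub>p W"
proof -
  obtain f g where "bij_betw f (verts T) (verts U)" "f (root T) = root U"
      "\<forall>v\<in>verts T. children U (f v) = map f (children T v)"
      "bij_betw g (verts U) (verts W)" "g (root U) = root W"
      "\<forall>v\<in>verts U. children W (g v) = map g (children U v)"
    using assms unfolding plane_tree_iso_def by blast
  then show ?thesis unfolding plane_tree_iso_def
    by (intro exI[of _ "g \<circ> f"]) (auto simp: bij_betw_trans dest: bij_betwE)
qed

text \<open>Isomorphic trees have isomorphic subtrees at corresponding children of their roots.\<close>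

lemma subtree_iso_children:
  assumes iso: "subtree T v \<cong>\<^sub>p subtree U w"
    and T: "child_closed T" "v \<in> verts T"
    and U: "child_closed U" "w \<in> verts U"
  shows "length (children T v) = length (children U w)"
    and "i < length (children T v) \<Longrightarrow>
      subtree T (children T v ! i) \<cong>\<^sub>p subtree U (children U w ! i)"
proof -
  obtain f where f: "inj_on f (verts (subtree T v))" "f v = w"
      "\<And>x. x \<in> verts (subtree T v) \<Longrightarrow> children U (f x) = map f (children T x)"
    using iso unfolding plane_tree_iso_def by (auto simp: bij_betw_def)
  have ch: "children U w = map f (children T v)"
    using f(2) f(3)[OF root_in_subtree] by simp
  then show "length (children T v) = length (children U w)" by simp
  assume i: "i < length (children T v)"
  define c where "c = children T v ! i"
  have c: "c \<in> set (children T v)" and fc: "children U w ! i = f c"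
    using i ch by (simp_all add: c_def)
  have sub: "verts (subtree T c) \<subseteq> verts (subtree T v)"
    using c T(2) root_in_subtree child_in_subtree verts_subtree_trans by metis
  have "f c \<in> set (children U w)" using c ch by simp
  then have "c \<in> verts T" "f c \<in> verts U"
    using c T U unfolding child_closed_def by blast+
  then have "subtree T c \<cong>\<^sub>p subtree U (f c)"
    using sub f by (intro subtree_isoI T(1) U(1)) (auto intro: inj_on_subset)
  then show "subtree T (children T v ! i) \<cong>\<^sub>p subtree U (children U w ! i)"
    by (simp add: fc flip: c_def)
qed

section \<open>Generating trees of inversion sequences\<close>

lemma verts_gen_tree_iff:
  "e \<in> verts (gen_tree B) \<longleftrightarrow>
    e \<noteq> [] \<and> (\<forall>i<length e. e ! i \<le> i) \<and> (\<forall>\<tau>\<in>B. \<not> contains_pattern e \<tau>)"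
proof (cases e)
  case Nil
  then show ?thesis by (simp add: gen_tree_def avoiders_def inv_seqs_def)
next
  case (Cons x xs)
  then have "length e = Suc n \<longleftrightarrow> n = length xs" for n by auto
  then have "e \<in> verts (gen_tree B) \<longleftrightarrow> e \<in> avoiders B (length xs)"
    by (simp add: gen_tree_def avoiders_def inv_seqs_def)
  then show ?thesis
    by (simp add: avoiders_def inv_seqs_def Cons less_Suc_eq_le)
qed

lemma child_letters_subset:
  "{k. e @ [k] \<in> verts (gen_tree B)} \<subseteq> {..length e}"
proof
  fix k assume "k \<in> {k. e @ [k] \<in> verts (gen_tree B)}"
  then have "(e @ [k]) ! length e \<le> length e"
    unfolding verts_gen_tree_iff by fastforce
  then show "k \<in> {..length e}" by simp
qed

lemma finite_child_letters: "finite {k. e @ [k] \<in> verts (gen_tree B)}"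
  using child_letters_subset finite_subset by blast

lemma children_gen_tree:
  "children (gen_tree B) e =
    map (\<lambda>k. e @ [k]) (sorted_list_of_set {k. e @ [k] \<in> verts (gen_tree B)})"
  by (simp add: gen_tree_def)

lemma child_closed_gen_tree: "child_closed (gen_tree B)"
  by (auto simp: child_closed_def children_gen_tree finite_child_letters)

lemma length_children_le: "length (children (gen_tree B) e) \<le> Suc (length e)"
  using card_mono[OF _ child_letters_subset[of e B]] by (simp add: children_gen_tree)

lemma subtree_gen_tree_prefix:
  assumes "w \<in> verts (subtree (gen_tree B) v)"
  obtains p where "w = v @ p"
proof -
  from assms have "\<exists>p. w = v @ p"
    by (induction rule: subtree_induct) (auto simp: children_gen_tree finite_child_letters)
  then show ?thesis using that by blast
qed

lemma root_gen_tree [simp]: "root (gen_tree B) = [0]"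
  by (simp add: gen_tree_def)

lemma reduced_tree_simps [simp]:
  "verts (reduced_tree B) = verts (gen_tree B)"
  "root (reduced_tree B) = root (gen_tree B)"
  "children (reduced_tree B) = children (gen_tree B)"
  "label (reduced_tree B) = representative B"
  by (simp_all add: reduced_tree_def plane_tree.defs)

lemma subtree_reduced_tree_iso_iff:
  "subtree (reduced_tree B) v \<cong>\<^sub>p U \<longleftrightarrow> subtree (gen_tree B) v \<cong>\<^sub>p U"
  by (simp add: plane_tree_iso_def verts_subtree)

section \<open>Representatives of equivalence classes\<close>

lemma lenlex_less_than_wf_total:
  "wf (lenlex less_than)" "total (lenlex less_than)"
  by (simp_all add: wf_lenlex total_lenlex)

lemma lenlex_less_than_antisym:
  "(x, y) \<in> lenlex less_than \<Longrightarrow> (y, x) \<notin> lenlex less_than"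
  by (meson lenlex_less_than_wf_total(1) wf_not_sym)

lemma representative_eqI:
  assumes "w \<in> equiv_class B v"
    and "\<And>u. \<lbrakk>u \<in> equiv_class B v; u \<noteq> w\<rbrakk> \<Longrightarrow> (w, u) \<in> lenlex less_than"
  shows "representative B v = w"
  unfolding representative_def
proof (rule the_equality)
  show "w \<in> equiv_class B v \<and> (\<forall>u\<in>equiv_class B v. u \<noteq> w \<longrightarrow> (w, u) \<in> lenlex less_than)"
    using assms by simp
next
  fix x
  assume x: "x \<in> equiv_class B v \<and> (\<forall>u\<in>equiv_class B v. u \<noteq> x \<longrightarrow> (x, u) \<in> lenlex less_than)"
  show "x = w"
  proof (rule ccontr)
    assume "x \<noteq> w"
    with x assms have "(w, x) \<in> lenlex less_than" "(x, w) \<in> lenlex less_than" by simp_all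
    then show False using lenlex_less_than_antisym by simp
  qed
qed

lemma representative_in_class:
  assumes "v \<in> verts (gen_tree B)"
  shows "representative B v \<in> equiv_class B v"
proof -
  have "v \<in> equiv_class B v"
    using assms by (simp add: equiv_class_def plane_tree_iso_refl)
  then obtain w where w: "w \<in> equiv_class B v"
      "\<And>u. (u, w) \<in> lenlex less_than \<Longrightarrow> u \<notin> equiv_class B v"
    using wfE_min[OF lenlex_less_than_wf_total(1)] by metis
  then have "representative B v = w"
    using lenlex_less_than_wf_total(2)
    by (intro representative_eqI) (auto simp: total_on_def)
  with w(1) show ?thesis by simp
qed

lemma zeros_lenlex_less:
  assumes "length u = n" and "u \<noteq> replicate n 0"
  shows "(replicate n 0, u) \<in> lenlex less_than"
  using assms
proof (induction n arbitrary: u)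
  case (Suc n)
  then obtain x xs where "u = x # xs" "length xs = n" by (cases u) auto
  with Suc show ?case by (cases "x = 0") (auto simp: Cons_lenlex_iff)
qed simp

text \<open>No condition on the words of length \<open>m\<close> is needed, since the all-zero word is the left-most node
  of its level.\<close>

lemma representative_eq_zerosI:
  assumes "replicate m 0 \<in> equiv_class B v"
    and "\<And>u. u \<in> equiv_class B v \<Longrightarrow> m \<le> length u"
  shows "representative B v = replicate m 0"
proof (rule representative_eqI[OF assms(1)])
  fix u assume u: "u \<in> equiv_class B v" "u \<noteq> replicate m 0"
  show "(replicate m 0, u) \<in> lenlex less_than"
  proof (cases "length u = m")
    case True
    with u show ?thesis by (simp add: zeros_lenlex_less)
  next
    case False
    with assms(2) u have "m < length u" by force
    then show ?thesis by (simp add: lenlex_conv)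
  qed
qed

section \<open>Words avoiding 100 and 012\<close>

lemma list_length3_conv: "length s = 3 \<longleftrightarrow> (\<exists>x y z. s = [x, y, z])"
  by (auto simp: numeral_3_eq_3 length_Suc_conv)

lemma contains_100_iff:
  "contains_pattern e [1, 0, 0] \<longleftrightarrow> (\<exists>x y. y < x \<and> subseq [x, y, y] e)"
proof -
  have iso: "order_isomorphic s [1, 0, 0] \<longleftrightarrow> (\<exists>x y. y < x \<and> s = [x, y, y])" for s
  proof -
    have "order_isomorphic [x, y, z] [1, 0, 0] \<longleftrightarrow> y < x \<and> z = y" for x y z
      by (auto simp: order_isomorphic_def All_less_Suc)
    moreover have "length s = 3" if "order_isomorphic s [1, 0, 0]"
      using that by (simp add: order_isomorphic_def)
    ultimately show ?thesis unfolding list_length3_conv by blast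
  qed
  show ?thesis unfolding contains_pattern_def iso by blast
qed

lemma contains_012_iff:
  "contains_pattern e [0, 1, 2] \<longleftrightarrow> (\<exists>x y z. x < y \<and> y < z \<and> subseq [x, y, z] e)"
proof -
  have iso: "order_isomorphic s [0, 1, 2] \<longleftrightarrow> (\<exists>x y z. x < y \<and> y < z \<and> s = [x, y, z])" for s
  proof -
    have "order_isomorphic [x, y, z] [0, 1, 2] \<longleftrightarrow> x < y \<and> y < z" for x y z
      by (auto simp: order_isomorphic_def All_less_Suc)
    moreover have "length s = 3" if "order_isomorphic s [0, 1, 2]"
      using that by (simp add: order_isomorphic_def)
    ultimately show ?thesis unfolding list_length3_conv by blast
  qed
  show ?thesis unfolding contains_pattern_def iso by blast
qed

lemma subseq_zeros_append:
  fixes x :: nat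
  assumes "0 < x"
  shows "subseq (x # xs) (replicate m 0 @ w) \<longleftrightarrow> subseq (x # xs) w"
  using assms by (induction m) auto

lemma zeros_append_contains_100_iff:
  "contains_pattern (replicate m 0 @ w) [1, 0, 0] \<longleftrightarrow> contains_pattern w [1, 0, 0]"
proof -
  have "subseq [x, y, y] (replicate m 0 @ w) \<longleftrightarrow> subseq [x, y, y] w" if "y < x" for x y
    using that by (intro subseq_zeros_append) simp
  then show ?thesis unfolding contains_100_iff by blast
qed

lemma zeros_append_contains_012_iff:
  assumes "1 \<le> m"
  shows "contains_pattern (replicate m 0 @ w) [0, 1, 2] \<longleftrightarrow>
    (\<exists>y z. 0 < y \<and> y < z \<and> subseq [y, z] w)"
proof
  assume "contains_pattern (replicate m 0 @ w) [0, 1, 2]"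
  then obtain x y z where xyz: "x < y" "y < z" "subseq [x, y, z] (replicate m 0 @ w)"
    unfolding contains_012_iff by blast
  then have "subseq [y, z] (replicate m 0 @ w)"
    by (meson subseq_Cons')
  with xyz show "\<exists>y z. 0 < y \<and> y < z \<and> subseq [y, z] w"
    using subseq_zeros_append[of y] by (metis gr_zeroI not_less0)
next
  assume "\<exists>y z. 0 < y \<and> y < z \<and> subseq [y, z] w"
  then obtain y z where yz: "0 < y" "y < z" "subseq [y, z] w" by blast
  have "subseq [0] (replicate m 0)"
    using assms by (simp add: subseq_singleton_left)
  with yz(3) have "subseq ([0] @ [y, z]) (replicate m 0 @ w)"
    by (intro list_emb_append_mono)
  with yz show "contains_pattern (replicate m 0 @ w) [0, 1, 2]"
    unfolding contains_012_iff by auto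
qed

text \<open>The right-hand side does not depend on \<open>m\<close>. The condition \<open>e\<^sub>i \<le> i\<close> is absent from it, since a
  letter exceeding \<open>j\<close> would form the pattern \<open>012\<close> with a zero and \<open>j\<close>.\<close>

lemma zeros_append_in_verts_iff:
  assumes "B = {[1, 0, 0], [0, 1, 2]}" and "1 \<le> j" and "j \<le> m"
  shows "replicate m 0 @ j # p \<in> verts (gen_tree B) \<longleftrightarrow>
    \<not> contains_pattern (j # p) [1, 0, 0] \<and> \<not> (\<exists>y z. 0 < y \<and> y < z \<and> subseq [y, z] (j # p))"
    (is "_ \<longleftrightarrow> _ \<and> \<not> ?R")
proof -
  have "(replicate m 0 @ j # p) ! i \<le> i"
    if "\<not> ?R" and i: "i < length (replicate m 0 @ j # p)" for i
  proof (cases "i < m")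
    case False
    have "z \<le> j" if "z \<in> set (j # p)" for z
    proof (rule ccontr)
      assume "\<not> z \<le> j"
      with that have "subseq [j, z] (j # p)" by (auto simp: subseq_singleton_left)
      moreover have "0 < j" "j < z" using \<open>\<not> z \<le> j\<close> assms(2) by simp_all
      ultimately show False using \<open>\<not> ?R\<close> by blast
    qed
    moreover have "(j # p) ! (i - m) \<in> set (j # p)"
      using i False by (intro nth_mem) simp
    ultimately have "(j # p) ! (i - m) \<le> j" by blast
    with False assms(3) show ?thesis by (simp add: nth_append)
  qed (simp add: nth_append)
  moreover have "1 \<le> m" using assms by simp
  ultimately show ?thesis
    unfolding verts_gen_tree_iff assms(1)
    using zeros_append_contains_100_iff[of m "j # p"] zeros_append_contains_012_iff[of m "j # p"]
    by auto
qed

lemma zeros_in_verts: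
  assumes "B = {[1, 0, 0], [0, 1, 2]}" and "1 \<le> m"
  shows "replicate m 0 \<in> verts (gen_tree B)"
proof -
  have "\<not> contains_pattern (replicate m 0) [1, 0, 0]"
    using zeros_append_contains_100_iff[of m "[]"] unfolding contains_100_iff by simp
  moreover have "\<not> contains_pattern (replicate m 0) [0, 1, 2]"
    using zeros_append_contains_012_iff[OF assms(2), of "[]"] by simp
  ultimately show ?thesis using assms by (auto simp: verts_gen_tree_iff)
qed

lemma zeros_snoc_in_verts_iff:
  assumes "B = {[1, 0, 0], [0, 1, 2]}" and "1 \<le> m"
  shows "replicate m 0 @ [k] \<in> verts (gen_tree B) \<longleftrightarrow> k \<le> m"
proof
  assume "replicate m 0 @ [k] \<in> verts (gen_tree B)"
  then show "k \<le> m" using child_letters_subset[of "replicate m 0" B] by auto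
next
  assume k: "k \<le> m"
  show "replicate m 0 @ [k] \<in> verts (gen_tree B)"
  proof (cases "k = 0")
    case True
    then show ?thesis using zeros_in_verts[OF assms(1), of "Suc m"]
      by (simp add: replicate_append_same)
  next
    case False
    with k show ?thesis
      using zeros_append_in_verts_iff[OF assms(1), of k m "[]"]
      unfolding contains_100_iff by (auto split: if_splits)
  qed
qed

lemma children_zeros:
  assumes "B = {[1, 0, 0], [0, 1, 2]}" and "1 \<le> m"
  shows "children (gen_tree B) (replicate m 0) = map (\<lambda>k. replicate m 0 @ [k]) [0..<Suc m]"
proof -
  have "{k. replicate m 0 @ [k] \<in> verts (gen_tree B)} = {0..<Suc m}"
    unfolding zeros_snoc_in_verts_iff[OF assms] by auto
  then show ?thesis by (simp only: children_gen_tree sorted_list_of_set_range)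
qed

lemma subtree_zeros_iso:
  assumes B: "B = {[1, 0, 0], [0, 1, 2]}" and j: "1 \<le> j" "j \<le> m"
  shows "subtree (gen_tree B) (replicate m 0 @ [j]) \<cong>\<^sub>p subtree (gen_tree B) (replicate j 0 @ [j])"
proof -
  let ?G = "gen_tree B" and ?v = "replicate m 0 @ [j]" and ?f = "drop (m - j) :: nat list \<Rightarrow> _"
  have f: "?f (?v @ p) = replicate j 0 @ [j] @ p" for p
    using j by simp
  have fv: "?f ?v = replicate j 0 @ [j]" using f[of "[]"] by simp
  have "subtree ?G ?v \<cong>\<^sub>p subtree ?G (?f ?v)"
  proof (rule subtree_isoI)
    show "?v \<in> verts ?G" "?f ?v \<in> verts ?G"
      using zeros_snoc_in_verts_iff[OF B] j unfolding fv by simp_all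
    show "inj_on ?f (verts (subtree ?G ?v))"
    proof (rule inj_onI)
      fix x y
      assume "x \<in> verts (subtree ?G ?v)" "y \<in> verts (subtree ?G ?v)" and eq: "?f x = ?f y"
      then obtain p q where "x = ?v @ p" "y = ?v @ q" by (metis subtree_gen_tree_prefix)
      with eq show "x = y" using f by simp
    qed
    fix x assume "x \<in> verts (subtree ?G ?v)"
    then obtain p where x: "x = ?v @ p" by (rule subtree_gen_tree_prefix)
    have letters: "?f x @ [k] \<in> verts ?G \<longleftrightarrow> x @ [k] \<in> verts ?G" for k
      unfolding x f using zeros_append_in_verts_iff[OF B j(1), of _ "p @ [k]"] j by simp
    have snoc: "?f (x @ [k]) = ?f x @ [k]" for k
      by (simp add: x)
    show "children ?G (?f x) = map ?f (children ?G x)"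
      by (simp only: children_gen_tree letters map_map o_def snoc)
  qed (rule child_closed_gen_tree)+
  then show ?thesis unfolding fv .
qed

lemma representative_eq_zeros:
  assumes B: "B = {[1, 0, 0], [0, 1, 2]}" and m: "1 \<le> m"
    and v: "v \<in> verts (gen_tree B)"
    and iso: "subtree (gen_tree B) v \<cong>\<^sub>p subtree (gen_tree B) (replicate m 0)"
  shows "representative B v = replicate m 0"
proof (rule representative_eq_zerosI)
  show "replicate m 0 \<in> equiv_class B v"
    using zeros_in_verts[OF B m] iso by (simp add: equiv_class_def)
next
  fix u assume "u \<in> equiv_class B v"
  then have u: "u \<in> verts (gen_tree B)" "subtree (gen_tree B) v \<cong>\<^sub>p subtree (gen_tree B) u"
    by (simp_all add: equiv_class_def)
  note len = subtree_iso_children(1)[OF _ child_closed_gen_tree v child_closed_gen_tree]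
  \<comment> \<open>\<open>u\<close> has as many children as \<open>0\<^sup>m\<close>, which is more than a word shorter than \<open>m\<close> can have.\<close>
  have "Suc m = length (children (gen_tree B) u)"
    using len[OF iso zeros_in_verts[OF B m]] len[OF u(2,1)] children_zeros[OF B m] by simp
  then show "m \<le> length u" using length_children_le[of B u] by simp
qed

section \<open>The generating tree\<close>

theorem proposition4p9:
  fixes B :: "nat list set"
    and \<T> :: "nat \<Rightarrow> nat list plane_tree"
    and a :: "nat \<Rightarrow> nat list"
  assumes B: "B = {[1,0,0], [0,1,2]}"
    and T: "\<And>m. m \<ge> 1 \<Longrightarrow> \<T> m = subtree (gen_tree B) (replicate m 0 @ [m])"
    and a: "\<And>m. m \<ge> 1 \<Longrightarrow> a m = replicate m 0"
  shows "label (reduced_tree B) (root (reduced_tree B)) = a 1 \<and>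
    (\<forall>m\<ge>1. \<forall>v\<in>verts (reduced_tree B). label (reduced_tree B) v = a m \<longrightarrow>
       length (children (reduced_tree B) v) = m + 1 \<and>
       label (reduced_tree B) (children (reduced_tree B) v ! 0) = a (m + 1) \<and>
       (\<forall>j\<in>{1..m}. subtree (reduced_tree B) (children (reduced_tree B) v ! j) \<cong>\<^sub>p \<T> j))"
proof (intro conjI allI impI ballI)
  let ?G = "gen_tree B"
  have "representative B [0] = replicate 1 0"
    using zeros_in_verts[OF B, of 1]
    by (intro representative_eq_zeros[OF B]) (simp_all add: plane_tree_iso_refl)
  then show "label (reduced_tree B) (root (reduced_tree B)) = a 1"
    by (simp add: a)

  fix m :: nat and v
  assume m: "1 \<le> m" and "v \<in> verts (reduced_tree B)" and lab: "label (reduced_tree B) v = a m"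
  then have v: "v \<in> verts ?G" by simp
  have iso: "subtree ?G v \<cong>\<^sub>p subtree ?G (replicate m 0)"
    using representative_in_class[OF v] lab a[OF m] by (simp add: equiv_class_def)
  note ch = subtree_iso_children[OF iso child_closed_gen_tree v
      child_closed_gen_tree zeros_in_verts[OF B m], unfolded children_zeros[OF B m]]
  from ch(1) have len: "length (children ?G v) = m + 1" by simp
  then show "length (children (reduced_tree B) v) = m + 1" by simp
  have child: "subtree ?G (children ?G v ! k) \<cong>\<^sub>p subtree ?G (replicate m 0 @ [k])"
    if "k \<le> m" for k
    using ch(2)[of k] that len by (simp add: nth_map[of _ "[0..<Suc m]"] del: upt_Suc)

  have "children ?G v ! 0 \<in> verts ?G"
    using v len child_closed_gen_tree[of B] by (force simp: child_closed_def)
  then have "representative B (children ?G v ! 0) = replicate (m + 1) 0"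
    using child[of 0] by (intro representative_eq_zeros[OF B]) (simp_all add: replicate_append_same)
  then show "label (reduced_tree B) (children (reduced_tree B) v ! 0) = a (m + 1)"
    by (simp add: a)

  fix j assume "j \<in> {1..m}"
  then have j: "1 \<le> j" "j \<le> m" by auto
  then show "subtree (reduced_tree B) (children (reduced_tree B) v ! j) \<cong>\<^sub>p \<T> j"
    using plane_tree_iso_trans[OF child subtree_zeros_iso[OF B]]
    by (simp add: subtree_reduced_tree_iso_iff T)
qed

end
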